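(* Let $k\geq 1$ and let $\phi_0,\ldots,\phi_{k-1}$ be propositional formulas such that $\bigwedge_{j<k}\phi_j$ is unsatisfiable in classical propositional logic. Then the formula $$\phi_0+\cdots+\phi_{k-1}\leq k-1$$ (a logical Bell's Inequality) is a validity of probabilistic team logic $\mathrm{PTL}$, and in consequence it is provable in the deductive system of $\mathrm{PTL}$.
   Context: **Propositional formulas.** Proposition symbols are $p_0,p_1,\ldots$; propositional formulas $\phi,\psi$ are built from them with $\neg,\wedge,\vee$. $\phi\equiv\psi$ denotes classical propositional equivalence. **Multi-teams.** A (finite) multi-team is a pair $X=(\Omega,\tau)$ with $\Omega$ a non-empty finite set and $\tau$ a function on $\Omega$ such that each $\tau(i)$, $i\in\Omega$, is a truth-value assignment for one and the same non-empty set of proposition symbols, denoted $\mathrm{dom}(X)$. For a propositional formula $\phi$ with symbols in $\mathrm{dom}(X)$, $$[\phi]_X=\frac{|\{i\in\Omega:\tau(i)(\phi)=1\}|}{|\Omega|}.$$ **Syntax of PTL.** Atomic formulas are $\sum_{j<k}a_j\phi_j\geq c$ with $k\geq1$, $\phi_j$ propositional formulas and $a_j,c\in\mathbb{Z}$. Formulas are closed under $\neg,\wedge$; other connectives are defined as usual. Abbreviations: $\sum_j a_j\phi_j\leq c$ is $\sum_j(-a_j)\phi_j\geq-c$; $t<c$ is $\neg(t\geq c)$; $t>c$ is $\neg(t\leq c)$; $t=c$ is $(t\geq c)\wedge(t\leq c)$; comparisons $t\geq t'$, $t=t'$ of two linear expressions mean $t-t'\geq0$, $t-t'=0$. **Semantics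 of PTL.** For a multi-team $X$ whose domain contains all proposition symbols of $\alpha$: $X\models\sum_{j<k}a_j\phi_j\geq c$ iff $\sum_{j<k}a_j[\phi_j]_X\geq c$; $X\models\neg\alpha$ iff $X\not\models\alpha$; $X\models\alpha\wedge\beta$ iff $X\models\alpha$ and $X\models\beta$. $\alpha$ is a validity of PTL if $X\models\alpha$ for every such multi-team $X$. **Deductive system of PTL.** Axioms and rules: - (A) all instances (by PTL formulas) of propositional tautologies; - (B) modus ponens; - (C) $\phi\geq0$; - (D) $\phi\vee\neg\phi=1$; - (E) $(\phi\wedge\psi)+(\phi\wedge\neg\psi)=\phi$; - (F) $\phi=\psi$ whenever $\phi\equiv\psi$ in propositional logic; - (G) $\phi\geq\phi$; - (H) $\sum_{j<k}a_j\phi_j\geq c\leftrightarrow\sum_{j<k}a_j\phi_j+0\psi\geq c$; - (I) $\sum_{j<k}a_j\phi_j\geq c\leftrightarrow\sum_{j<k}a_{\sigma(j)}\phi_{\sigma(j)}\geq c$ for $\sigma$ a permutation of $k$; - (J) $\big(\sum_{j<k}a_j\phi_j\geq c\wedge\sum_{j<k}b_j\phi_j\geq d\big)\rightarrow\sum_{j<k}(a_j+b_j)\phi_j\geq c+d$; - (K) $\sum_{j<k}a_j\phi_j\geq c\leftrightarrow\sum_{j<k}da_j\phi_j\geq dc$ for integers $d>0$; - (L) $\sum_{j<k}a_j\phi_j\geq c\vee\sum_{j<k}a_j\phi_j\leq c$; - (M) $\sum_{j<k}a_j\phi_j\geq c\rightarrow\sum_{j<k}a_j\phi_j>d$ for $c>d$.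 A formula is provable if it is the last formula of a finite sequence of PTL formulas each of which is an axiom or follows from earlier ones by modus ponens. *)

theory Defs
  imports Complex_Main "HOL-Combinatorics.Permutations"
begin

subsection \<open>Propositional logic\<close>

datatype pform = PSym nat | PNeg pform | PAnd pform pform | POr pform pform

fun psyms :: "pform \<Rightarrow> nat set" where
  "psyms (PSym n) = {n}"
| "psyms (PNeg \<phi>) = psyms \<phi>"
| "psyms (PAnd \<phi> \<psi>) = psyms \<phi> \<union> psyms \<psi>"
| "psyms (POr \<phi> \<psi>) = psyms \<phi> \<union> psyms \<psi>"

fun peval :: "(nat \<Rightarrow> bool) \<Rightarrow> pform \<Rightarrow> bool" where
  "peval v (PSym n) \<longleftrightarrow> v n"
| "peval v (PNeg \<phi>) \<longleftrightarrow> \<not> peval v \<phi>"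
| "peval v (PAnd \<phi> \<psi>) \<longleftrightarrow> peval v \<phi> \<and> peval v \<psi>"
| "peval v (POr \<phi> \<psi>) \<longleftrightarrow> peval v \<phi> \<or> peval v \<psi>"

definition psatisfiable :: "pform \<Rightarrow> bool" where
  "psatisfiable \<phi> \<longleftrightarrow> (\<exists>v. peval v \<phi>)"

definition ptautology :: "pform \<Rightarrow> bool" where
  "ptautology \<phi> \<longleftrightarrow> (\<forall>v. peval v \<phi>)"

definition pequiv :: "pform \<Rightarrow> pform \<Rightarrow> bool" where
  "pequiv \<phi> \<psi> \<longleftrightarrow> (\<forall>v. peval v \<phi> \<longleftrightarrow> peval v \<psi>)"

(* Conjunction of \<phi> 0, ..., \<phi> (k - 1); only meaningful for k \<ge> 1. *)
definition big_conj :: "nat \<Rightarrow> (nat \<Rightarrow> pform) \<Rightarrow> pform" where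
  "big_conj k \<phi> = foldl PAnd (\<phi> 0) (map \<phi> [1..<k])"


subsection \<open>Multi-teams\<close>

(* Only the values of the second component on the index set matter. *)
type_synonym 'i multi_team = "'i set \<times> ('i \<Rightarrow> nat \<rightharpoonup> bool)"

fun is_multi_team :: "'i multi_team \<Rightarrow> bool" where
  "is_multi_team (\<Omega>, \<tau>) \<longleftrightarrow>
     finite \<Omega> \<and> \<Omega> \<noteq> {} \<and> (\<exists>D. D \<noteq> {} \<and> (\<forall>i\<in>\<Omega>. dom (\<tau> i) = D))"

(* In a multi-team all the assignments have the same domain, so the union is that domain. *)
fun team_dom :: "'i multi_team \<Rightarrow> nat set" where
  "team_dom (\<Omega>, \<tau>) = (\<Union>i\<in>\<Omega>. dom (\<tau> i))"

(* Only used for formulas with psyms \<phi> \<subseteq> team_dom X, where each value is defined. *)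
fun prob :: "'i multi_team \<Rightarrow> pform \<Rightarrow> real" where
  "prob (\<Omega>, \<tau>) \<phi> = real (card {i \<in> \<Omega>. peval (\<lambda>n. the (\<tau> i n)) \<phi>}) / real (card \<Omega>)"


subsection \<open>Syntax of PTL\<close>

type_synonym lin = "(int \<times> pform) list"

definition lsum :: "nat \<Rightarrow> (nat \<Rightarrow> int) \<Rightarrow> (nat \<Rightarrow> pform) \<Rightarrow> lin" where
  "lsum k a \<phi> = map (\<lambda>j. (a j, \<phi> j)) [0..<k]"

definition lneg :: "lin \<Rightarrow> lin" where
  "lneg t = map (\<lambda>(a, \<phi>). (- a, \<phi>)) t"

definition lminus :: "lin \<Rightarrow> lin \<Rightarrow> lin" where
  "lminus t t' = t @ lneg t'"

datatype ptl = Geq lin int | Neg ptl | And ptl ptl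

(* The datatype also contains atoms with an empty sum, which are not formulas of PTL. *)
fun is_ptl :: "ptl \<Rightarrow> bool" where
  "is_ptl (Geq t c) \<longleftrightarrow> t \<noteq> []"
| "is_ptl (Neg \<alpha>) \<longleftrightarrow> is_ptl \<alpha>"
| "is_ptl (And \<alpha> \<beta>) \<longleftrightarrow> is_ptl \<alpha> \<and> is_ptl \<beta>"

fun ptl_syms :: "ptl \<Rightarrow> nat set" where
  "ptl_syms (Geq t c) = (\<Union>(a, \<phi>)\<in>set t. psyms \<phi>)"
| "ptl_syms (Neg \<alpha>) = ptl_syms \<alpha>"
| "ptl_syms (And \<alpha> \<beta>) = ptl_syms \<alpha> \<union> ptl_syms \<beta>"

definition Or :: "ptl \<Rightarrow> ptl \<Rightarrow> ptl" where
  "Or \<alpha> \<beta> = Neg (And (Neg \<alpha>) (Neg \<beta>))"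

definition Imp :: "ptl \<Rightarrow> ptl \<Rightarrow> ptl" where
  "Imp \<alpha> \<beta> = Or (Neg \<alpha>) \<beta>"

definition Iff :: "ptl \<Rightarrow> ptl \<Rightarrow> ptl" where
  "Iff \<alpha> \<beta> = And (Imp \<alpha> \<beta>) (Imp \<beta> \<alpha>)"

definition Leq :: "lin \<Rightarrow> int \<Rightarrow> ptl" where
  "Leq t c = Geq (lneg t) (- c)"

definition Gt :: "lin \<Rightarrow> int \<Rightarrow> ptl" where
  "Gt t c = Neg (Leq t c)"

definition Eq :: "lin \<Rightarrow> int \<Rightarrow> ptl" where
  "Eq t c = And (Geq t c) (Leq t c)"

definition Geq_lin :: "lin \<Rightarrow> lin \<Rightarrow> ptl" where
  "Geq_lin t t' = Geq (lminus t t') 0"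

definition Eq_lin :: "lin \<Rightarrow> lin \<Rightarrow> ptl" where
  "Eq_lin t t' = Eq (lminus t t') 0"


subsection \<open>Semantics of PTL\<close>

fun ptl_sat :: "'i multi_team \<Rightarrow> ptl \<Rightarrow> bool" where
  "ptl_sat X (Geq t c) \<longleftrightarrow> (\<Sum>(a, \<phi>)\<leftarrow>t. real_of_int a * prob X \<phi>) \<ge> real_of_int c"
| "ptl_sat X (Neg \<alpha>) \<longleftrightarrow> \<not> ptl_sat X \<alpha>"
| "ptl_sat X (And \<alpha> \<beta>) \<longleftrightarrow> ptl_sat X \<alpha> \<and> ptl_sat X \<beta>"

(* A definition cannot quantify over the type of the indices, hence the type argument.
   Validity is truth in all multi-teams, with indices of any type 'i. *)
definition ptl_valid :: "'i itself \<Rightarrow> ptl \<Rightarrow> bool" where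
  "ptl_valid _ \<alpha> \<longleftrightarrow>
     (\<forall>X :: 'i multi_team. is_multi_team X \<and> ptl_syms \<alpha> \<subseteq> team_dom X \<longrightarrow> ptl_sat X \<alpha>)"


subsection \<open>Deductive system of PTL\<close>

fun instantiate :: "(nat \<Rightarrow> ptl) \<Rightarrow> pform \<Rightarrow> ptl" where
  "instantiate s (PSym n) = s n"
| "instantiate s (PNeg \<phi>) = Neg (instantiate s \<phi>)"
| "instantiate s (PAnd \<phi> \<psi>) = And (instantiate s \<phi>) (instantiate s \<psi>)"
| "instantiate s (POr \<phi> \<psi>) = Or (instantiate s \<phi>) (instantiate s \<psi>)"

(* Instances that are not PTL formulas (empty sums) are excluded in is_derivation. *)
inductive ptl_axiom :: "ptl \<Rightarrow> bool" where
  ax_A: "ptautology \<chi> \<Longrightarrow> ptl_axiom (instantiate s \<chi>)"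
| ax_C: "ptl_axiom (Geq [(1, \<phi>)] 0)"
| ax_D: "ptl_axiom (Eq [(1, POr \<phi> (PNeg \<phi>))] 1)"
| ax_E: "ptl_axiom (Eq_lin [(1, PAnd \<phi> \<psi>), (1, PAnd \<phi> (PNeg \<psi>))] [(1, \<phi>)])"
| ax_F: "pequiv \<phi> \<psi> \<Longrightarrow> ptl_axiom (Eq_lin [(1, \<phi>)] [(1, \<psi>)])"
| ax_G: "ptl_axiom (Geq_lin [(1, \<phi>)] [(1, \<phi>)])"
| ax_H: "ptl_axiom (Iff (Geq (lsum k a \<Phi>) c) (Geq (lsum k a \<Phi> @ [(0, \<psi>)]) c))"
| ax_I: "\<sigma> permutes {..<k} \<Longrightarrow>
    ptl_axiom (Iff (Geq (lsum k a \<Phi>) c) (Geq (lsum k (\<lambda>j. a (\<sigma> j)) (\<lambda>j. \<Phi> (\<sigma> j))) c))"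
| ax_J: "ptl_axiom (Imp (And (Geq (lsum k a \<Phi>) c) (Geq (lsum k b \<Phi>) d))
                        (Geq (lsum k (\<lambda>j. a j + b j) \<Phi>) (c + d)))"
| ax_K: "d > 0 \<Longrightarrow>
    ptl_axiom (Iff (Geq (lsum k a \<Phi>) c) (Geq (lsum k (\<lambda>j. d * a j) \<Phi>) (d * c)))"
| ax_L: "ptl_axiom (Or (Geq (lsum k a \<Phi>) c) (Leq (lsum k a \<Phi>) c))"
| ax_M: "c > d \<Longrightarrow> ptl_axiom (Imp (Geq (lsum k a \<Phi>) c) (Gt (lsum k a \<Phi>) d))"

definition is_derivation :: "ptl list \<Rightarrow> bool" where
  "is_derivation \<pi> \<longleftrightarrow>
     (\<forall>i<length \<pi>. is_ptl (\<pi> ! i) \<and>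
        (ptl_axiom (\<pi> ! i) \<or> (\<exists>j<i. \<exists>l<i. \<pi> ! l = Imp (\<pi> ! j) (\<pi> ! i))))"

definition ptl_provable :: "ptl \<Rightarrow> bool" where
  "ptl_provable \<alpha> \<longleftrightarrow> (\<exists>\<pi>. \<pi> \<noteq> [] \<and> is_derivation \<pi> \<and> last \<pi> = \<alpha>)"

end

(* Provability: the coefficient sum of a derivable inequality may be manipulated freely (reordering,
   adding inequalities, cancelling a formula against its negative).  Since \<phi> \<and> \<psi> \<ge> \<phi> + \<psi> - 1 is
   derivable, induction yields that the conjunction of all \<phi> j is at least
   \<phi> 0 + ... + \<phi> (k - 1) - (k - 1); and an unsatisfiable formula \<chi> has \<chi> \<le> 0, because
   it is equivalent both to \<chi> \<and> \<chi> and to \<chi> \<and> \<not> \<chi>, whose probabilities add up to that of \<chi>. *)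
theory Submission
  imports Defs
begin

subsection \<open>Propositional reasoning in PTL\<close>

lemma is_ptl_connectives [simp]:
  "is_ptl (Or \<alpha> \<beta>) \<longleftrightarrow> is_ptl \<alpha> \<and> is_ptl \<beta>"
  "is_ptl (Imp \<alpha> \<beta>) \<longleftrightarrow> is_ptl \<alpha> \<and> is_ptl \<beta>"
  "is_ptl (Iff \<alpha> \<beta>) \<longleftrightarrow> is_ptl \<alpha> \<and> is_ptl \<beta>"
  by (auto simp: Or_def Imp_def Iff_def)

lemma provable_is_ptl: "ptl_provable \<alpha> \<Longrightarrow> is_ptl \<alpha>"
  unfolding ptl_provable_def is_derivation_def
  by (metis diff_less last_conv_nth length_greater_0_conv zero_less_one)

lemma provable_axiom:
  assumes "ptl_axiom \<alpha>" "is_ptl \<alpha>"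
  shows "ptl_provable \<alpha>"
  unfolding ptl_provable_def is_derivation_def using assms by (intro exI[of _ "[\<alpha>]"]) auto

text \<open>Premises of modus ponens are referred to by position. Those of \<open>\<rho>\<close> all
  shift by \<open>length \<pi>\<close>, so they still precede their conclusion.\<close>

lemma is_derivation_append:
  assumes "is_derivation \<pi>" "is_derivation \<rho>"
  shows "is_derivation (\<pi> @ \<rho>)"
  unfolding is_derivation_def
proof (intro allI impI)
  fix i assume i: "i < length (\<pi> @ \<rho>)"
  show "is_ptl ((\<pi> @ \<rho>) ! i) \<and> (ptl_axiom ((\<pi> @ \<rho>) ! i) \<or>
      (\<exists>j<i. \<exists>l<i. (\<pi> @ \<rho>) ! l = Imp ((\<pi> @ \<rho>) ! j) ((\<pi> @ \<rho>) ! i)))"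
  proof (cases "i < length \<pi>")
    case True
    then have eq: "(\<pi> @ \<rho>) ! j = \<pi> ! j" if "j \<le> i" for j
      using that by (simp add: nth_append)
    show ?thesis
      using assms(1) True unfolding is_derivation_def by (metis eq order_refl less_imp_le)
  next
    case False
    define m where "m = i - length \<pi>"
    have m: "i = length \<pi> + m" "m < length \<rho>"
      using False i by (auto simp: m_def)
    have "is_ptl (\<rho> ! m)"
      and "ptl_axiom (\<rho> ! m) \<or> (\<exists>j<m. \<exists>l<m. \<rho> ! l = Imp (\<rho> ! j) (\<rho> ! m))"
      using assms(2) m unfolding is_derivation_def by auto
    then show ?thesis
      unfolding m(1) by (metis nth_append_length_plus nat_add_left_cancel_less)
  qed
qed

lemma provable_mp:
  assumes "ptl_provable (Imp \<alpha> \<beta>)" "ptl_provable \<alpha>"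
  shows "ptl_provable \<beta>"
proof -
  obtain \<pi> \<rho> where \<pi>: "\<pi> \<noteq> []" "is_derivation \<pi>" "last \<pi> = Imp \<alpha> \<beta>"
    and \<rho>: "\<rho> \<noteq> []" "is_derivation \<rho>" "last \<rho> = \<alpha>"
    using assms unfolding ptl_provable_def by blast
  define \<sigma> where "\<sigma> = \<pi> @ \<rho>"
  have \<sigma>: "is_derivation \<sigma>"
    unfolding \<sigma>_def by (rule is_derivation_append[OF \<pi>(2) \<rho>(2)])
  have "Imp \<alpha> \<beta> \<in> set \<sigma>" "\<alpha> \<in> set \<sigma>"
    using \<pi> \<rho> last_in_set unfolding \<sigma>_def by fastforce+
  then obtain j l where jl: "j < length \<sigma>" "\<sigma> ! j = \<alpha>" "l < length \<sigma>" "\<sigma> ! l = Imp \<alpha> \<beta>"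
    by (metis in_set_conv_nth)
  have "is_ptl \<beta>"
    using provable_is_ptl[OF assms(1)] by simp
  with \<sigma> jl have "is_derivation (\<sigma> @ [\<beta>])"
    unfolding is_derivation_def
    by (fastforce simp: nth_append less_Suc_eq)
  then show ?thesis
    unfolding ptl_provable_def by (intro exI[of _ "\<sigma> @ [\<beta>]"]) simp
qed

lemma provable_tautology:
  assumes "ptautology \<chi>" "is_ptl (instantiate s \<chi>)"
  shows "ptl_provable (instantiate s \<chi>)"
  using assms by (intro provable_axiom ax_A)

lemma provable_conjD1:
  assumes "ptl_provable (And \<alpha> \<beta>)"
  shows "ptl_provable \<alpha>"
proof -
  \<comment> \<open>The substitution sends symbol 0 to \<open>\<alpha>\<close> and every other
    symbol to \<open>\<beta>\<close>. The schema uses \<open>PNeg\<close> and \<open>POr\<close>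
    because \<open>Imp\<close> unfolds to exactly that shape.\<close>
  have "ptl_provable (instantiate (case_nat \<alpha> (\<lambda>_. \<beta>))
      (POr (PNeg (PAnd (PSym 0) (PSym 1))) (PSym 0)))"
    using provable_is_ptl[OF assms] by (intro provable_tautology) (auto simp: ptautology_def)
  then have "ptl_provable (Imp (And \<alpha> \<beta>) \<alpha>)"
    by (simp add: Imp_def)
  then show ?thesis
    using assms by (rule provable_mp)
qed

lemma provable_conjD2:
  assumes "ptl_provable (And \<alpha> \<beta>)"
  shows "ptl_provable \<beta>"
proof -
  have "ptl_provable (instantiate (case_nat \<alpha> (\<lambda>_. \<beta>))
      (POr (PNeg (PAnd (PSym 0) (PSym 1))) (PSym 1)))"
    using provable_is_ptl[OF assms] by (intro provable_tautology) (auto simp: ptautology_def)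
  then have "ptl_provable (Imp (And \<alpha> \<beta>) \<beta>)"
    by (simp add: Imp_def)
  then show ?thesis
    using assms by (rule provable_mp)
qed

lemma provable_conjI:
  assumes "ptl_provable \<alpha>" "ptl_provable \<beta>"
  shows "ptl_provable (And \<alpha> \<beta>)"
proof -
  have "ptl_provable (instantiate (case_nat \<alpha> (\<lambda>_. \<beta>))
      (POr (PNeg (PSym 0)) (POr (PNeg (PSym 1)) (PAnd (PSym 0) (PSym 1)))))"
    using assms[THEN provable_is_ptl]
    by (intro provable_tautology) (auto simp: ptautology_def)
  then have "ptl_provable (Imp \<alpha> (Imp \<beta> (And \<alpha> \<beta>)))"
    by (simp add: Imp_def)
  then show ?thesis
    using assms by (blast intro: provable_mp)
qed

lemma provable_iffD1: "ptl_provable (Iff \<alpha> \<beta>) \<Longrightarrow> ptl_provable \<alpha> \<Longrightarrow> ptl_provable \<beta>"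
  unfolding Iff_def by (blast intro: provable_mp dest: provable_conjD1)

lemma provable_iffD2: "ptl_provable (Iff \<alpha> \<beta>) \<Longrightarrow> ptl_provable \<beta> \<Longrightarrow> ptl_provable \<alpha>"
  unfolding Iff_def by (blast intro: provable_mp dest: provable_conjD2)


subsection \<open>Linear inequalities in PTL\<close>

text \<open>The axioms speak of indexed sums \<open>lsum\<close>, whereas the derivations manipulate
  lists; this translates between the two.\<close>

lemma map_eq_lsum:
  "map (\<lambda>x. (a x, f x)) xs = lsum (length xs) (\<lambda>j. a (xs ! j)) (\<lambda>j. f (xs ! j))"
  unfolding lsum_def by (rule nth_equalityI) auto

lemma eq_lsum: "t = lsum (length t) (\<lambda>j. fst (t ! j)) (\<lambda>j. snd (t ! j))"
  using map_eq_lsum[of fst snd t] by simp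

lemma lsum_eq_Nil_iff [simp]: "lsum k a \<phi> = [] \<longleftrightarrow> k = 0"
  by (simp add: lsum_def)

lemma provable_Geq_nonempty: "ptl_provable (Geq t c) \<Longrightarrow> t \<noteq> []"
  using provable_is_ptl by fastforce

text \<open>Lists with equal multisets differ by a permutation of positions, so axiom (I) applies.
  Reordering thereby reduces to a multiset equation.\<close>

lemma provable_Geq_mset:
  assumes "ptl_provable (Geq t c)" "mset t' = mset t"
  shows "ptl_provable (Geq t' c)"
proof -
  obtain \<sigma> where \<sigma>: "\<sigma> permutes {..<length t}" "permute_list \<sigma> t = t'"
    using mset_eq_permutation[OF assms(2)] by blast
  have "t' = lsum (length t) (\<lambda>j. fst (t ! \<sigma> j)) (\<lambda>j. snd (t ! \<sigma> j))"
    using \<sigma>(2) by (auto simp: permute_list_def lsum_def)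
  moreover have "ptl_axiom (Iff (Geq t c)
      (Geq (lsum (length t) (\<lambda>j. fst (t ! \<sigma> j)) (\<lambda>j. snd (t ! \<sigma> j))) c))"
    using ax_I[OF \<sigma>(1), of "\<lambda>j. fst (t ! j)" "\<lambda>j. snd (t ! j)" c]
    by (simp add: eq_lsum[of t, symmetric])
  ultimately have "ptl_axiom (Iff (Geq t c) (Geq t' c))"
    by simp
  moreover have "t \<noteq> []" "t' \<noteq> []"
    using provable_Geq_nonempty[OF assms(1)] assms(2) by auto
  ultimately have "ptl_provable (Iff (Geq t c) (Geq t' c))"
    by (simp add: provable_axiom)
  then show ?thesis
    using assms(1) by (rule provable_iffD1)
qed

lemma provable_Geq_zero_iff:
  assumes "t \<noteq> []"
  shows "ptl_provable (Geq (t @ [(0, \<psi>)]) c) \<longleftrightarrow> ptl_provable (Geq t c)"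
proof -
  have "ptl_axiom (Iff (Geq t c) (Geq (t @ [(0, \<psi>)]) c))"
    using ax_H[of "length t" "\<lambda>j. fst (t ! j)" "\<lambda>j. snd (t ! j)" c \<psi>]
    by (simp add: eq_lsum[of t, symmetric])
  then have "ptl_provable (Iff (Geq t c) (Geq (t @ [(0, \<psi>)]) c))"
    using assms by (simp add: provable_axiom)
  then show ?thesis
    using provable_iffD1 provable_iffD2 by blast
qed

text \<open>Axiom (H) attaches zero terms at the right end only, hence the induction from the
  right.\<close>

lemma provable_Geq_zeros_iff:
  assumes "t \<noteq> []"
  shows "ptl_provable (Geq (t @ map (Pair 0) \<psi>s) c) \<longleftrightarrow> ptl_provable (Geq t c)"
proof (induction \<psi>s rule: rev_induct)
  case (snoc \<psi> \<psi>s)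
  then show ?case
    using provable_Geq_zero_iff[of "t @ map (Pair 0) \<psi>s" \<psi> c] assms by simp
qed simp

text \<open>Axiom (J) adds sums over the same formulas in the same order; the common list
  \<open>xs\<close> with \<open>f\<close> enforces this.\<close>

lemma provable_Geq_add_coeffs:
  assumes "ptl_provable (Geq (map (\<lambda>x. (a x, f x)) xs) c)"
    and "ptl_provable (Geq (map (\<lambda>x. (b x, f x)) xs) d)"
  shows "ptl_provable (Geq (map (\<lambda>x. (a x + b x, f x)) xs) (c + d))"
proof -
  have "xs \<noteq> []"
    using provable_Geq_nonempty[OF assms(1)] by simp
  then have "ptl_provable (Imp (And (Geq (map (\<lambda>x. (a x, f x)) xs) c)
      (Geq (map (\<lambda>x. (b x, f x)) xs) d)) (Geq (map (\<lambda>x. (a x + b x, f x)) xs) (c + d)))"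
    unfolding map_eq_lsum by (intro provable_axiom ax_J) simp
  then show ?thesis
    using provable_conjI[OF assms] by (rule provable_mp)
qed

text \<open>Each sum is padded with the formulas of the other at coefficient 0; adding coefficients
  then yields the concatenation.\<close>

lemma provable_Geq_append:
  assumes "ptl_provable (Geq t c)" "ptl_provable (Geq t' d)"
  shows "ptl_provable (Geq (t @ t') (c + d))"
proof -
  \<comment> \<open>A triple holds the coefficient in the first inequality, the one in the second,
    and the formula.\<close>
  let ?xs = "map (\<lambda>(a, \<phi>). (a, 0, \<phi>)) t @ map (\<lambda>(b, \<phi>). (0, b, \<phi>)) t'"
  let ?f = "\<lambda>(a, b, \<phi>). \<phi>"
  have l: "map (\<lambda>x. (fst x, ?f x)) ?xs = t @ map (Pair 0) (map snd t')"
    by (auto simp: case_prod_beta intro!: map_idI)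
  have r: "map (\<lambda>x. (fst (snd x), ?f x)) ?xs = map (Pair 0) (map snd t) @ t'"
    by (auto simp: case_prod_beta intro!: map_idI)
  have s: "map (\<lambda>x. (fst x + fst (snd x), ?f x)) ?xs = t @ t'"
    by (auto simp: case_prod_beta intro!: map_idI)
  have "ptl_provable (Geq (t @ map (Pair 0) (map snd t')) c)"
    using assms(1) provable_Geq_nonempty provable_Geq_zeros_iff by blast
  moreover have "ptl_provable (Geq (t' @ map (Pair 0) (map snd t)) d)"
    using assms(2) provable_Geq_nonempty provable_Geq_zeros_iff by blast
  then have "ptl_provable (Geq (map (Pair 0) (map snd t) @ t') d)"
    by (rule provable_Geq_mset) (simp add: add.commute)
  ultimately show ?thesis
    using provable_Geq_add_coeffs[of fst ?f ?xs c "\<lambda>x. fst (snd x)" d] unfolding l r s by blast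
qed

text \<open>Axiom (G) is the case \<open>a = 1\<close>; axiom (K) scales it to positive
  \<open>a\<close>, and reordering gives negative \<open>a\<close>.\<close>

lemma provable_Geq_minus_self: "ptl_provable (Geq [(a, \<phi>), (- a, \<phi>)] 0)"
proof -
  have refl: "ptl_provable (Geq [(1, \<phi>), (- 1, \<phi>)] 0)"
    using provable_axiom[OF ax_G[of \<phi>]] by (simp add: Geq_lin_def lminus_def lneg_def)
  have pos: "ptl_provable (Geq [(d, \<phi>), (- d, \<phi>)] 0)" if "d > 0" for d
  proof -
    have "ptl_provable (Iff (Geq (map (\<lambda>x. (x, \<phi>)) [1, - 1]) 0)
        (Geq (map (\<lambda>x. (d * x, \<phi>)) [1, - 1]) (d * 0)))"
      unfolding map_eq_lsum using that by (intro provable_axiom ax_K) simp_all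
    then show ?thesis
      using refl by (auto dest: provable_iffD1)
  qed
  consider "a > 0" | "a < 0" | "a = 0"
    by linarith
  then show ?thesis
  proof cases
    case 1
    then show ?thesis by (rule pos)
  next
    case 2
    then have "ptl_provable (Geq [(- a, \<phi>), (a, \<phi>)] 0)"
      using pos[of "- a"] by simp
    then show ?thesis
      by (rule provable_Geq_mset) simp
  next
    case 3
    have "ptl_provable (Geq [(0, \<phi>)] 0)"
    proof -
      have "ptl_provable (Geq ([(1, \<phi>), (- 1, \<phi>)]) 0)"
        by (rule refl)
      moreover from this have "ptl_provable (Geq ([(- 1, \<phi>), (1, \<phi>)]) 0)"
        by (rule provable_Geq_mset) simp
      ultimately have "ptl_provable (Geq [(0, \<phi>), (0, \<phi>)] 0)"
        using provable_Geq_add_coeffs[of id "\<lambda>_. \<phi>" "[1, - 1]" 0 uminus 0] by simp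
      then show ?thesis
        using provable_Geq_zero_iff[of "[(0, \<phi>)]" \<phi> 0] by simp
    qed
    then show ?thesis
      using 3 provable_Geq_zero_iff[of "[(0, \<phi>)]" \<phi> 0] by simp
  qed
qed

lemma provable_Geq_cancel:
  assumes "ptl_provable (Geq (t @ [(a, \<phi>), (- a, \<phi>)]) c)" "t \<noteq> []"
  shows "ptl_provable (Geq t c)"
proof -
  let ?xs = "map (\<lambda>(a, \<phi>). (a, 0, \<phi>)) t @ [(a, - a, \<phi>), (- a, a, \<phi>)]"
  let ?f = "\<lambda>(a, b, \<phi>). \<phi>"
  have l: "map (\<lambda>x. (fst x, ?f x)) ?xs = t @ [(a, \<phi>), (- a, \<phi>)]"
    by (auto simp: case_prod_beta intro!: map_idI)
  have r: "map (\<lambda>x. (fst (snd x), ?f x)) ?xs = map (Pair 0) (map snd t) @ [(- a, \<phi>), (a, \<phi>)]"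
    by (auto simp: case_prod_beta)
  have s: "map (\<lambda>x. (fst x + fst (snd x), ?f x)) ?xs = t @ map (Pair 0) [\<phi>, \<phi>]"
    by (auto simp: case_prod_beta intro!: map_idI)
  have "ptl_provable (Geq ([(a, \<phi>), (- a, \<phi>)] @ map (Pair 0) (map snd t)) 0)"
    using provable_Geq_minus_self provable_Geq_zeros_iff by blast
  then have "ptl_provable (Geq (map (Pair 0) (map snd t) @ [(- a, \<phi>), (a, \<phi>)]) 0)"
    by (rule provable_Geq_mset) simp
  then have "ptl_provable (Geq (t @ map (Pair 0) [\<phi>, \<phi>]) (c + 0))"
    using provable_Geq_add_coeffs[of fst ?f ?xs c "\<lambda>x. fst (snd x)" 0] assms(1)
    unfolding l r s by blast
  then show ?thesis
    by (simp only: provable_Geq_zeros_iff[OF assms(2)] add_0_right)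
qed

text \<open>The main tool below: two inequalities are added and one intermediate formula is
  eliminated. The bound stays literally \<open>c + d\<close>, which is why later proofs carry
  unevaluated sums of constants.\<close>

lemma provable_Geq_cut:
  assumes "ptl_provable (Geq t c)" "ptl_provable (Geq t' d)"
    and "mset t + mset t' = mset s + {#(a, \<phi>), (- a, \<phi>)#}" "s \<noteq> []"
  shows "ptl_provable (Geq s (c + d))"
proof (rule provable_Geq_cancel[OF _ assms(4)])
  show "ptl_provable (Geq (s @ [(a, \<phi>), (- a, \<phi>)]) (c + d))"
    using provable_Geq_append[OF assms(1,2)]
    by (rule provable_Geq_mset) (simp add: assms(3))
qed


subsection \<open>Probabilities of conjunctions\<close>

lemma provable_split_ge:
  "ptl_provable (Geq [(1, PAnd \<phi> \<psi>), (1, PAnd \<phi> (PNeg \<psi>)), (- 1, \<phi>)] 0)"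
  using provable_axiom[OF ax_E[of \<phi> \<psi>], unfolded Eq_lin_def Eq_def, THEN provable_conjD1]
  by (simp add: Leq_def lminus_def lneg_def)

lemma provable_split_le:
  "ptl_provable (Geq [(1, \<phi>), (- 1, PAnd \<phi> \<psi>), (- 1, PAnd \<phi> (PNeg \<psi>))] 0)"
proof (rule provable_Geq_mset)
  show "ptl_provable (Geq [(- 1, PAnd \<phi> \<psi>), (- 1, PAnd \<phi> (PNeg \<psi>)), (1, \<phi>)] 0)"
    using provable_axiom[OF ax_E[of \<phi> \<psi>], unfolded Eq_lin_def Eq_def, THEN provable_conjD2]
    by (simp add: Leq_def lminus_def lneg_def)
qed simp

text \<open>One half of the equality in axiom (F); the other half arises by exchanging the formulas,
  as \<open>pequiv\<close> is symmetric.\<close>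

lemma provable_pequiv:
  assumes "pequiv \<phi> \<psi>"
  shows "ptl_provable (Geq [(1, \<phi>), (- 1, \<psi>)] 0)"
  using provable_axiom[OF ax_F[OF assms], unfolded Eq_lin_def Eq_def, THEN provable_conjD1]
  by (simp add: Leq_def lminus_def lneg_def)

lemma provable_excluded_middle_le: "ptl_provable (Geq [(- 1, POr \<phi> (PNeg \<phi>))] (- 1))"
  using provable_axiom[OF ax_D[of \<phi>], unfolded Eq_def, THEN provable_conjD2]
  by (simp add: Leq_def lneg_def)

lemma provable_nonneg: "ptl_provable (Geq [(1, \<phi>)] 0)"
  by (simp add: provable_axiom ax_C)

text \<open>The part of \<psi> outside \<phi> has probability at most 1 - \<phi>, and the rest of
  \<psi> is the conjunction.\<close>

lemma provable_conj_lower_bound: "ptl_provable (Geq [(1, PAnd \<phi> \<psi>), (- 1, \<phi>), (- 1, \<psi>)] (- 1))"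
proof -
  define T where "T = POr \<phi> (PNeg \<phi>)"
  \<comment> \<open>\<open>N\<close> is equivalent to the negation of \<phi>, written so that axiom
    (E) splits \<open>T\<close> into \<open>PAnd T \<phi>\<close> and \<open>N\<close>.\<close>
  define N where "N = PAnd T (PNeg \<phi>)"
  have "ptl_provable (Geq [(- 1, PAnd T \<phi>), (- 1, N)] (- 1 + 0))"
    using provable_excluded_middle_le[of \<phi>] provable_split_le[of T \<phi>] unfolding N_def
    by (rule provable_Geq_cut[where a = "- 1" and \<phi> = T]) (simp_all add: T_def)
  moreover have "ptl_provable (Geq [(1, PAnd T \<phi>), (- 1, \<phi>)] 0)"
    by (rule provable_pequiv) (auto simp: pequiv_def T_def)
  ultimately have 1: "ptl_provable (Geq [(- 1, \<phi>), (- 1, N)] (- 1 + 0 + 0))"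
    by (rule provable_Geq_cut[where a = "- 1" and \<phi> = "PAnd T \<phi>"]) simp_all
  \<comment> \<open>Monotonicity: splitting \<open>N\<close> by \<psi> leaves a non-negative
    remainder.\<close>
  have "ptl_provable (Geq [(1, N), (- 1, PAnd N \<psi>)] (0 + 0))"
    using provable_split_le[of N \<psi>] provable_nonneg[of "PAnd N (PNeg \<psi>)"]
    by (rule provable_Geq_cut[where a = "- 1" and \<phi> = "PAnd N (PNeg \<psi>)"]) simp_all
  with 1 have 2: "ptl_provable (Geq [(- 1, \<phi>), (- 1, PAnd N \<psi>)] (- 1 + 0 + 0 + (0 + 0)))"
    by (rule provable_Geq_cut[where a = "- 1" and \<phi> = N]) simp_all
  have "ptl_provable (Geq [(1, PAnd N \<psi>), (- 1, PAnd \<psi> (PNeg \<phi>))] 0)"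
    by (rule provable_pequiv) (auto simp: pequiv_def N_def T_def)
  with 2 have 3: "ptl_provable (Geq [(- 1, \<phi>), (- 1, PAnd \<psi> (PNeg \<phi>))]
      (- 1 + 0 + 0 + (0 + 0) + 0))"
    by (rule provable_Geq_cut[where a = "- 1" and \<phi> = "PAnd N \<psi>"]) simp_all
  \<comment> \<open>Splitting \<psi> by \<phi> replaces the part of \<psi> outside \<phi> by \<psi>
    minus the conjunction.\<close>
  have "ptl_provable (Geq [(- 1, \<phi>), (1, PAnd \<psi> \<phi>), (- 1, \<psi>)]
      (- 1 + 0 + 0 + (0 + 0) + 0 + 0))"
    using 3 provable_split_ge[of \<psi> \<phi>]
    by (rule provable_Geq_cut[where a = "- 1" and \<phi> = "PAnd \<psi> (PNeg \<phi>)"]) simp_all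
  moreover have "ptl_provable (Geq [(1, PAnd \<phi> \<psi>), (- 1, PAnd \<psi> \<phi>)] 0)"
    by (rule provable_pequiv) (auto simp: pequiv_def)
  ultimately have "ptl_provable (Geq [(1, PAnd \<phi> \<psi>), (- 1, \<phi>), (- 1, \<psi>)]
      (- 1 + 0 + 0 + (0 + 0) + 0 + 0 + 0))"
    by (rule provable_Geq_cut[where a = 1 and \<phi> = "PAnd \<psi> \<phi>"]) simp_all
  then show ?thesis
    by simp
qed

lemma provable_unsat_le:
  assumes "\<not> psatisfiable \<chi>"
  shows "ptl_provable (Geq [(- 1, \<chi>)] 0)"
proof -
  let ?N = "PAnd \<chi> (PNeg \<chi>)"
  have sq: "ptl_provable (Geq [(1, PAnd \<chi> \<chi>), (- 1, \<chi>)] 0)"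
    by (rule provable_pequiv) (auto simp: pequiv_def)
  have "ptl_provable (Geq [(1, ?N), (- 1, \<chi>)] 0)"
    by (rule provable_pequiv) (use assms in \<open>auto simp: pequiv_def psatisfiable_def\<close>)
  moreover have "ptl_provable (Geq [(1, \<chi>), (- 1, \<chi>), (- 1, ?N)] (0 + 0))"
    using provable_split_le[of \<chi> \<chi>] sq
    by (rule provable_Geq_cut[where a = "- 1" and \<phi> = "PAnd \<chi> \<chi>"]) simp_all
  ultimately have "ptl_provable (Geq [(- 1, \<chi>), (1, \<chi>), (- 1, \<chi>)] (0 + (0 + 0)))"
    by (rule provable_Geq_cut[where a = 1 and \<phi> = ?N]) simp_all
  \<comment> \<open>Each cut removes a single pair, so the inequality obtained is - \<chi> + \<chi>
    - \<chi> \<ge> 0, and one opposite pair is still to be cancelled.\<close>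
  then show ?thesis
    using provable_Geq_cancel[of "[(- 1, \<chi>)]" 1 \<chi> 0] by simp
qed

section \<open>Conjunctions of finitely many formulas\<close>

lemma big_conj_Suc: "k \<ge> 1 \<Longrightarrow> big_conj (Suc k) \<phi> = PAnd (big_conj k \<phi>) (\<phi> k)"
  by (simp add: big_conj_def)

lemma peval_big_conj: "k \<ge> 1 \<Longrightarrow> peval v (big_conj k \<phi>) \<longleftrightarrow> (\<forall>j<k. peval v (\<phi> j))"
proof (induction k rule: dec_induct)
  case base
  then show ?case by (simp add: big_conj_def)
next
  case (step k)
  then show ?case by (auto simp: big_conj_Suc less_Suc_eq)
qed

text \<open>The first conjunct costs nothing and each further one costs 1, by the binary bound;
  hence the constant \<open>1 - int k\<close>.\<close>

lemma provable_big_conj_lower_bound: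
  assumes "k \<ge> 1"
  shows "ptl_provable (Geq (lneg (lsum k (\<lambda>_. 1) \<phi>) @ [(1, big_conj k \<phi>)]) (1 - int k))"
  using assms
proof (induction k rule: dec_induct)
  case base
  then show ?case
    using provable_Geq_minus_self[of "- 1" "\<phi> 0"] by (simp add: lneg_def lsum_def big_conj_def)
next
  case (step k)
  have "ptl_provable (Geq (lneg (lsum (Suc k) (\<lambda>_. 1) \<phi>) @ [(1, big_conj (Suc k) \<phi>)])
      (1 - int k + - 1))"
    using step.IH provable_conj_lower_bound[of "big_conj k \<phi>" "\<phi> k"]
    by (rule provable_Geq_cut[where a = 1 and \<phi> = "big_conj k \<phi>"])
      (use step.hyps in \<open>simp_all add: lneg_def lsum_def big_conj_Suc\<close>)
  then show ?case
    by (simp add: algebra_simps)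
qed

section \<open>The inequality in multi-teams\<close>

text \<open>Double counting of the pairs of an index \<open>i\<close> and a formula
  \<open>\<phi> j\<close> true at \<open>i\<close>: every assignment falsifies some formula, so each
  \<open>i\<close> contributes at most \<open>k - 1\<close> pairs.\<close>

lemma sum_prob_le:
  assumes "is_multi_team X" "\<And>v. \<exists>j<k. \<not> peval v (\<phi> j)"
  shows "(\<Sum>j<k. prob X (\<phi> j)) \<le> real k - 1"
proof -
  obtain \<Omega> \<tau> where X: "X = (\<Omega>, \<tau>)"
    by (cases X)
  have fin: "finite \<Omega>" "\<Omega> \<noteq> {}"
    using assms(1) by (auto simp: X)
  \<comment> \<open>Outside the domain of \<open>\<tau> i\<close> the values are unspecified, but
    the second assumption covers every total valuation.\<close>
  define E where "E i j \<longleftrightarrow> peval (\<lambda>n. the (\<tau> i n)) (\<phi> j)" for i j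
  have bound: "card {j \<in> {..<k}. E i j} \<le> k - 1" for i
  proof -
    obtain j where "j < k" "\<not> E i j"
      using assms(2) unfolding E_def by blast
    then have "card {j \<in> {..<k}. E i j} < card {..<k}"
      by (intro psubset_card_mono) auto
    then show ?thesis by simp
  qed
  \<comment> \<open>For \<open>k = 0\<close> no formula could fail. This makes the natural number
    \<open>k - 1\<close> agree with the real difference.\<close>
  have k: "k \<ge> 1"
    using assms(2) by (metis less_one not_less less_nat_zero_code)
  have "(\<Sum>j<k. card {i \<in> \<Omega>. E i j}) = (\<Sum>i\<in>\<Omega>. card {j \<in> {..<k}. E i j})"
    using fin sum.swap_restrict[of "{..<k}" \<Omega> "\<lambda>_ _. 1 :: nat" "\<lambda>j i. E i j"]
    unfolding card_eq_sum by blast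
  also have "\<dots> \<le> card \<Omega> * (k - 1)"
    using sum_bounded_above[of \<Omega> "\<lambda>i. card {j \<in> {..<k}. E i j}" "k - 1"] bound by simp
  finally have "real (\<Sum>j<k. card {i \<in> \<Omega>. E i j}) \<le> real (card \<Omega> * (k - 1))"
    by (rule of_nat_mono)
  then have "(\<Sum>j<k. real (card {i \<in> \<Omega>. E i j})) \<le> real (card \<Omega>) * (real k - 1)"
    using k by (simp add: of_nat_diff)
  moreover have "(\<Sum>j<k. prob X (\<phi> j)) = (\<Sum>j<k. real (card {i \<in> \<Omega>. E i j})) / real (card \<Omega>)"
    by (simp add: X E_def sum_divide_distrib)
  moreover have "card \<Omega> > 0"
    using fin by (simp add: card_gt_0_iff)
  ultimately show ?thesis
    by (simp add: divide_le_eq mult.commute)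
qed

theorem mainTheorem2:
  fixes k :: nat and \<phi> :: "nat \<Rightarrow> pform"
  assumes "k \<ge> 1"
    and "\<not> psatisfiable (big_conj k \<phi>)"
  shows "ptl_valid TYPE('i) (Leq (lsum k (\<lambda>_. 1) \<phi>) (int k - 1))
       \<and> ptl_provable (Leq (lsum k (\<lambda>_. 1) \<phi>) (int k - 1))"
proof
  have "\<exists>j<k. \<not> peval v (\<phi> j)" for v
    using assms peval_big_conj unfolding psatisfiable_def by blast
  then have le: "(\<Sum>j<k. prob X (\<phi> j)) \<le> real k - 1" if "is_multi_team X"
    for X :: "'i multi_team"
    using sum_prob_le that by blast
  \<comment> \<open>\<open>Leq\<close> abbreviates a \<open>Geq\<close> with negated coefficients,
    so the semantic bound is needed with its sign reversed.\<close>
  have eq: "(\<Sum>(a, \<psi>)\<leftarrow>lneg (lsum k (\<lambda>_. 1) \<phi>). real_of_int a * prob X \<psi>)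
      = - (\<Sum>j<k. prob X (\<phi> j))" for X :: "'i multi_team"
    by (induction k) (simp_all add: lneg_def lsum_def)
  show "ptl_valid TYPE('i) (Leq (lsum k (\<lambda>_. 1) \<phi>) (int k - 1))"
    unfolding ptl_valid_def Leq_def ptl_sat.simps eq
  proof (intro allI impI, elim conjE)
    fix X :: "'i multi_team"
    assume "is_multi_team X"
    from le[OF this] show "real_of_int (- (int k - 1)) \<le> - (\<Sum>j<k. prob X (\<phi> j))"
      by simp
  qed
next
  \<comment> \<open>The conjunction is eliminated between its lower bound and the upper bound 0
    given by unsatisfiability.\<close>
  have "ptl_provable (Geq (lneg (lsum k (\<lambda>_. 1) \<phi>)) (1 - int k + 0))"
    using provable_big_conj_lower_bound[OF assms(1)] provable_unsat_le[OF assms(2)]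
    by (rule provable_Geq_cut[where a = 1 and \<phi> = "big_conj k \<phi>"])
      (use assms(1) in \<open>simp_all add: lneg_def\<close>)
  then show "ptl_provable (Leq (lsum k (\<lambda>_. 1) \<phi>) (int k - 1))"
    by (simp add: Leq_def)
qed

end
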